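(* Let $H$ be a nonseparable Hilbert space and let $B_H$ be the closed unit ball of $H$ equipped with the weak topology. Then, for any real numbers $0<\lambda<\mu$, there is no extension operator $T: C(\lambda B_H)\to C(\mu B_H)$.
   Context: For a compact Hausdorff space $K$, $C(K)$ is the Banach space of continuous real-valued functions on $K$ with the supremum norm. If $L$ is a closed subspace of $K$, a bounded linear operator $T:C(L)\to C(K)$ is called an extension operator if, for every $f\in C(L)$, $Tf$ is an extension of $f$, i.e. $(Tf)|_L=f$. The balls $\lambda B_H=\{x\in H:\|x\|\le\lambda\}\subset \mu B_H=\{x\in H:\|x\|\le\mu\}$ carry the weak topology of $H$, in which they are compact. *)

theory Defs
  imports "HOL-Analysis.Analysis"
begin

text \<open>The coarsest topology making every bounded linear functional continuous, as the pullback
  of the product topology (cf. \<open>strong_operator_topology\<close>).\<close>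

definition weak_topology :: "'a::real_normed_vector topology" where
  "weak_topology = pullback_topology UNIV (\<lambda>x (f :: 'a \<Rightarrow>\<^sub>L real). blinfun_apply f x) euclidean"

lemma topspace_weak_topology [simp]: "topspace weak_topology = UNIV"
  by (simp add: weak_topology_def topspace_pullback_topology)

lemma continuous_map_weak_topology_blinfun:
  "continuous_map weak_topology euclideanreal (blinfun_apply f)"
proof -
  have "continuous_map euclidean euclideanreal (\<lambda>g :: ('a \<Rightarrow>\<^sub>L real) \<Rightarrow> real. g f)"
    by (simp add: continuous_map_iff_continuous2)
  then have "continuous_map weak_topology euclideanreal
      ((\<lambda>g :: ('a \<Rightarrow>\<^sub>L real) \<Rightarrow> real. g f) \<circ> (\<lambda>x f. blinfun_apply f x))"
    unfolding weak_topology_def by (rule continuous_map_pullback)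
  then show ?thesis
    by (simp add: o_def)
qed

definition weak_ball :: "real \<Rightarrow> 'a::real_normed_vector topology" where
  "weak_ball r = subtopology weak_topology (cball 0 r)"

text \<open>A function on \<open>X\<close> is represented by its extension to the whole type that is
  \<open>undefined\<close> outside \<open>topspace X\<close>. The carrier of \<open>cfunspace\<close> also asks for boundedness;
  for compact \<open>X\<close>, the only case of interest, this is automatic, see \<open>C_space_compact\<close>.\<close>

definition C_space :: "'a topology \<Rightarrow> ('a \<Rightarrow> real) set" where
  "C_space X = mspace (cfunspace X euclidean_metric)"

definition sup_norm :: "'a topology \<Rightarrow> ('a \<Rightarrow> real) \<Rightarrow> real" where
  "sup_norm X f = mdist (cfunspace X euclidean_metric) f (\<lambda>x\<in>topspace X. 0)"

lemma C_space_compact: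
  assumes "compact_space X"
  shows "C_space X = {f \<in> extensional (topspace X). continuous_map X euclideanreal f}"
  using compactin_mspace_cfunspace [of X "euclidean_metric :: real metric"] assms
  by (auto simp: C_space_def compact_space_def)

lemma sup_norm_eq_SUP:
  assumes "f \<in> C_space X" "topspace X \<noteq> {}"
  shows "sup_norm X f = (SUP x\<in>topspace X. \<bar>f x\<bar>)"
proof (rule antisym)
  have "continuous_map X euclideanreal (\<lambda>x\<in>topspace X. 0)"
    by (rule continuous_map_eq [where f = "\<lambda>x. 0"]) auto
  moreover have "(\<lambda>x\<in>topspace X. 0::real) ` topspace X = {0}"
    using assms(2) by (simp only: image_restrict_eq image_constant_conv if_False)
  ultimately have 0: "(\<lambda>x\<in>topspace X. 0) \<in> mspace (cfunspace X (euclidean_metric :: real metric))"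
    by (simp add: Met_TC.mbounded_insert Met_TC.mbounded_empty)
  note f = assms(1) [unfolded C_space_def]
  note le = cfunspace_mdist_le [OF f 0 assms(2)]
  have ub: "\<bar>f x\<bar> \<le> sup_norm X f" if "x \<in> topspace X" for x
    using le [of "sup_norm X f"] that by (auto simp: sup_norm_def dist_real_def)
  then have "bdd_above ((\<lambda>x. \<bar>f x\<bar>) ` topspace X)"
    by (meson bdd_above.I2)
  then show "sup_norm X f \<le> (SUP x\<in>topspace X. \<bar>f x\<bar>)"
    unfolding sup_norm_def le by (auto simp: dist_real_def intro: cSUP_upper)
  show "(SUP x\<in>topspace X. \<bar>f x\<bar>) \<le> sup_norm X f"
    using assms(2) ub by (rule cSUP_least)
qed

definition bounded_linear_operator ::
    "'a topology \<Rightarrow> 'b topology \<Rightarrow> (('a \<Rightarrow> real) \<Rightarrow> 'b \<Rightarrow> real) \<Rightarrow> bool" where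
  "bounded_linear_operator X Y T \<longleftrightarrow>
     T \<in> C_space X \<rightarrow> C_space Y \<and>
     (\<forall>f\<in>C_space X. \<forall>g\<in>C_space X.
        T (\<lambda>x\<in>topspace X. f x + g x) = (\<lambda>y\<in>topspace Y. T f y + T g y)) \<and>
     (\<forall>c. \<forall>f\<in>C_space X. T (\<lambda>x\<in>topspace X. c * f x) = (\<lambda>y\<in>topspace Y. c * T f y)) \<and>
     (\<exists>M. \<forall>f\<in>C_space X. sup_norm Y (T f) \<le> M * sup_norm X f)"

text \<open>Meant for \<open>K\<close> compact Hausdorff and \<open>L\<close> a closed subset of it.\<close>

definition extension_operator ::
    "'a topology \<Rightarrow> 'a set \<Rightarrow> (('a \<Rightarrow> real) \<Rightarrow> 'a \<Rightarrow> real) \<Rightarrow> bool" where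
  "extension_operator K L T \<longleftrightarrow>
     bounded_linear_operator (subtopology K L) K T \<and>
     (\<forall>f\<in>C_space (subtopology K L). restrict (T f) L = f)"

lemma subtopology_weak_ball:
  "r \<le> s \<Longrightarrow> subtopology (weak_ball s) (cball 0 r) = weak_ball r"
  by (simp add: weak_ball_def subtopology_subtopology inf_absorb2 subset_cball)

end

theory Submission
  imports Defs
begin

text \<open>
  Why there is no extension operator. Fix an uncountable orthonormal set \<open>B\<close>, a number \<open>k\<close> and
  then \<open>m\<close> so large that \<open>n = m + k\<close> satisfies \<open>n / m \<le> (\<mu> / \<kappa>)\<^sup>2\<close>. With \<open>t = \<kappa> / sqrt m\<close>, the vector
  \<open>x\<^sub>A = t (\<Sum>e\<in>A. e)\<close> lies in the small ball if \<open>A \<subseteq> B\<close> has \<open>m\<close> elements, and in the large one if \<open>A\<close> has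
  at most \<open>n\<close>. For \<open>S \<subseteq> B\<close> with \<open>m\<close> elements let \<open>f\<^sub>S\<close> be a weakly continuous bump, with values
  in \<open>[0, 1]\<close>, that is \<open>1\<close> at \<open>x\<^sub>S\<close> and vanishes at \<open>y\<close> unless every coordinate \<open>y \<bullet> e\<close>
  with \<open>e \<in> S\<close> exceeds \<open>\<kappa> / sqrt (m + 1)\<close>. By Bessel's inequality a point of the small ball has at
  most \<open>m\<close> such coordinates, so the supports of distinct bumps are disjoint there
  (\<open>bumps_disjoint\<close>), and a sum of \<open>k + 1\<close> of them still has norm at most \<open>1\<close>.

  On the other hand, let \<open>T\<close> be an extension operator. Suppose that \<open>a\<^sub>0, \<dots>, a\<^bsub>n-1\<^esub>\<close> in \<open>B\<close> can be chosen so
  that, for each of the \<open>k + 1\<close> windows \<open>S\<close> of \<open>m\<close> consecutive \<open>a\<^sub>i\<close>, the value of \<open>T f\<^sub>S\<close> hardly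
  changes between the full point \<open>x = x\<^sub>A\<close>, \<open>A = {a\<^sub>0, \<dots>, a\<^bsub>n-1\<^esub>}\<close>, and \<open>x\<^sub>S\<close>. Since \<open>T f\<^sub>S\<close> extends \<open>f\<^sub>S\<close>, it is \<open>1\<close> at
  \<open>x\<^sub>S\<close>, hence at least \<open>1 / 2\<close> at \<open>x\<close>. Adding up, \<open>T\<close> maps a function of norm at most \<open>1\<close> to
  one that is at least \<open>(k + 1) / 2\<close> at \<open>x\<close>. As \<open>k\<close> was arbitrary, \<open>T\<close> is unbounded.

  The choice of the \<open>a\<^sub>i\<close> (\<open>nearly_free_sequence\<close>) is where uncountability enters. An orthonormal
  sequence tends weakly to \<open>0\<close>, so adding \<open>t e\<close> to a point changes a weakly continuous function by
  \<open>\<epsilon>\<close> or more for only finitely many \<open>e \<in> B\<close>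
  (\<open>finite_weakly_sensitive_directions\<close>), and changes it at all for only countably many. One
  therefore finds countably infinite layers \<open>X\<^sub>0, X\<^sub>1, \<dots>\<close> in \<open>B\<close> such that a direction in \<open>X\<^sub>i\<close> is
  irrelevant to every function and every point built from the earlier layers. Then \<open>a\<^sub>i \<in> X\<^sub>i\<close> is
  chosen for \<open>i = n - 1\<close> first and \<open>i = 0\<close> last, each time avoiding the finitely many directions
  that matter to what was chosen before. So directions above a window can be dropped
  at no cost because of the layers, and those below it at little cost because of the order of choice.
  Directions that lie strictly between elements of \<open>S\<close> are not controlled, which is why
  only windows of consecutive elements are used.
\<close>

section \<open>Orthonormal sets\<close>

definition orthonormal :: "'a::real_inner set \<Rightarrow> bool" where
  "orthonormal B \<longleftrightarrow> pairwise orthogonal B \<and> (\<forall>e\<in>B. norm e = 1)"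

lemma orthonormal_subset: "orthonormal B \<Longrightarrow> A \<subseteq> B \<Longrightarrow> orthonormal A"
  by (auto simp: orthonormal_def intro: pairwise_subset)

lemma orthonormal_inner:
  assumes "orthonormal B" "x \<in> B" "y \<in> B"
  shows "x \<bullet> y = (if x = y then 1 else 0)"
  using assms by (auto simp: orthonormal_def pairwise_def orthogonal_def dot_square_norm)

lemma norm_sum_orthonormal:
  assumes "orthonormal A" "finite A"
  shows "(norm (\<Sum>e\<in>A. c e *\<^sub>R e))\<^sup>2 = (\<Sum>e\<in>A. (c e)\<^sup>2)"
proof -
  have "pairwise (\<lambda>i j. orthogonal (c i *\<^sub>R i) (c j *\<^sub>R j)) A"
    using assms(1) by (auto simp: orthonormal_def pairwise_def orthogonal_def)
  then have "(norm (\<Sum>e\<in>A. c e *\<^sub>R e))\<^sup>2 = (\<Sum>e\<in>A. (norm (c e *\<^sub>R e))\<^sup>2)"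
    using assms(2) by (intro norm_sum_Pythagorean)
  also have "\<dots> = (\<Sum>e\<in>A. (c e)\<^sup>2)"
    using assms(1) by (intro sum.cong) (auto simp: orthonormal_def)
  finally show ?thesis .
qed

lemma norm_scaled_sum_orthonormal:
  assumes "orthonormal A" "finite A"
  shows "(norm (t *\<^sub>R \<Sum>A))\<^sup>2 = real (card A) * t\<^sup>2"
  using norm_sum_orthonormal [OF assms, of "\<lambda>_. t"] by (simp add: scaleR_sum_right)

text \<open>Bessel's inequality, for a functional rather than a vector. This avoids representing the
  functional by a vector: it suffices to evaluate it at \<open>\<Sum>e\<in>A. f e *\<^sub>R e\<close>.\<close>

lemma Bessel_functional:
  assumes "orthonormal A" "finite A" "linear f" and bound: "\<And>y. \<bar>f y\<bar> \<le> K * norm y"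
  shows "(\<Sum>e\<in>A. (f e)\<^sup>2) \<le> (K::real)\<^sup>2"
proof -
  define y where "y = (\<Sum>e\<in>A. f e *\<^sub>R e)"
  have ny: "(norm y)\<^sup>2 = (\<Sum>e\<in>A. (f e)\<^sup>2)"
    unfolding y_def by (rule norm_sum_orthonormal [OF assms(1,2)])
  have "f y = (\<Sum>e\<in>A. (f e)\<^sup>2)"
    unfolding y_def by (simp add: linear_sum [OF assms(3)] linear_scale [OF assms(3)] power2_eq_square)
  with bound [of y] ny have le: "norm y * norm y \<le> K * norm y"
    by (simp add: power2_eq_square)
  have "norm y \<le> \<bar>K\<bar>"
  proof (cases "norm y = 0")
    case False
    then have "norm y \<le> K"
      using le by simp
    then show ?thesis by linarith
  qed simp
  then show ?thesis
    unfolding ny [symmetric] by (metis abs_le_square_iff abs_norm_cancel)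
qed

lemma Bessel:
  assumes "orthonormal A" "finite A"
  shows "(\<Sum>e\<in>A. (x \<bullet> e)\<^sup>2) \<le> (norm x)\<^sup>2"
  using assms by (intro Bessel_functional)
    (auto simp: Cauchy_Schwarz_ineq2 intro: bounded_linear.linear bounded_linear_inner_right)

text \<open>The squared distance between two partial sums is a difference of two partial sums of the
  series of squared coefficients, which converges by Bessel's inequality.\<close>

lemma orthonormal_expansion_converges:
  fixes x :: "'a::{real_inner, complete_space}"
  assumes B: "orthonormal B" and A: "incseq A" "\<And>n. finite (A n)" "\<And>n. A n \<subseteq> B"
  obtains s where "(\<lambda>n. \<Sum>e\<in>A n. (x \<bullet> e) *\<^sub>R e) \<longlonglongrightarrow> s"
    and "\<And>n e. e \<in> A n \<Longrightarrow> s \<bullet> e = x \<bullet> e"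
proof -
  define s where "s n = (\<Sum>e\<in>A n. (x \<bullet> e) *\<^sub>R e)" for n
  define q where "q n = (\<Sum>e\<in>A n. (x \<bullet> e)\<^sup>2)" for n
  have "incseq q"
    unfolding q_def using A by (intro monoI sum_mono2) (auto dest: incseqD)
  moreover have "q n \<le> (norm x)\<^sup>2" for n
    unfolding q_def using A(2) orthonormal_subset [OF B A(3)] by (intro Bessel)
  ultimately obtain Q where "q \<longlonglongrightarrow> Q"
    by (metis incseq_convergent)
  then have q: "Cauchy q"
    by (rule LIMSEQ_imp_Cauchy)
  have diff: "(norm (s n - s m))\<^sup>2 = q n - q m" if "m \<le> n" for m n
  proof -
    have sub: "A m \<subseteq> A n"
      using A(1) that by (rule incseqD)
    have "s n - s m = (\<Sum>e\<in>A n - A m. (x \<bullet> e) *\<^sub>R e)"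
      unfolding s_def by (simp add: sum_diff [OF A(2) sub])
    moreover have "q n - q m = (\<Sum>e\<in>A n - A m. (x \<bullet> e)\<^sup>2)"
      unfolding q_def by (simp add: sum_diff [OF A(2) sub])
    moreover have "orthonormal (A n - A m)"
      using B by (rule orthonormal_subset) (use A(3) in auto)
    ultimately show ?thesis
      using A(2) by (simp add: norm_sum_orthonormal)
  qed
  have "Cauchy s"
  proof (rule CauchyI')
    fix \<epsilon> :: real assume \<epsilon>: "0 < \<epsilon>"
    then have "0 < \<epsilon>\<^sup>2" by simp
    then obtain N where N: "\<And>m n. N \<le> m \<Longrightarrow> N \<le> n \<Longrightarrow> norm (q m - q n) < \<epsilon>\<^sup>2"
      using CauchyD [OF q] by meson
    have "dist (s m) (s n) < \<epsilon>" if "N \<le> m" "m < n" for m n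
    proof -
      have "(norm (s n - s m))\<^sup>2 < \<epsilon>\<^sup>2"
        using N [of n m] diff [of m n] that by auto
      then have "norm (s n - s m) < \<epsilon>"
        using \<epsilon> by (auto intro: power2_less_imp_less)
      then show ?thesis by (simp add: dist_norm norm_minus_commute)
    qed
    then show "\<exists>N. \<forall>m\<ge>N. \<forall>n>m. dist (s m) (s n) < \<epsilon>" by blast
  qed
  then obtain L where L: "s \<longlonglongrightarrow> L"
    using Cauchy_convergent convergent_def by blast
  have "L \<bullet> e = x \<bullet> e" if e: "e \<in> A k" for k e
  proof -
    have "s n \<bullet> e = x \<bullet> e" if "k \<le> n" for n
    proof -
      have en: "e \<in> A n"
        using A(1) that e by (auto dest: incseqD)
      have "s n \<bullet> e = (\<Sum>e'\<in>A n. if e' = e then x \<bullet> e else 0)"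
        unfolding s_def inner_sum_left
        using orthonormal_inner [OF B] A(3) [of n] en by (intro sum.cong) (auto simp: subset_iff)
      then show ?thesis
        using en A(2) by simp
    qed
    then have "(\<lambda>n. s n \<bullet> e) \<longlonglongrightarrow> x \<bullet> e"
      by (intro tendsto_eventually) (auto simp: eventually_sequentially)
    moreover have "(\<lambda>n. s n \<bullet> e) \<longlonglongrightarrow> L \<bullet> e"
      by (intro tendsto_intros L)
    ultimately show ?thesis
      by (rule LIMSEQ_unique [symmetric])
  qed
  with L show thesis
    by (intro that [of L]) (auto simp: s_def [abs_def])
qed

text \<open>A maximal orthonormal set works. If it were countable, then every vector would be the sum of
  its expansion, since the difference is orthogonal to the set; and finite sums
  whose coefficients come from a countable dense set of coefficient sequences would be dense.\<close>

lemma uncountable_orthonormal_set: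
  assumes nonsep: "\<not> separable_space (euclidean :: 'h::{real_inner, complete_space} topology)"
  obtains B :: "'h::{real_inner, complete_space} set" where "orthonormal B" "uncountable B"
proof -
  have "\<exists>B\<in>Collect orthonormal. \<forall>X\<in>Collect orthonormal. B \<subseteq> X \<longrightarrow> X = (B::'h set)"
  proof (rule subset_Zorn')
    fix C :: "'h set set"
    assume C: "subset.chain (Collect orthonormal) C"
    have "pairwise orthogonal (\<Union>C)"
      using C by (intro pairwise_chain_Union) (auto simp: subset.chain_def chain_subset_def orthonormal_def)
    then show "\<Union>C \<in> Collect orthonormal"
      using C by (auto simp: subset.chain_def orthonormal_def)
  qed
  then obtain B :: "'h set" where B: "orthonormal B"
    and max: "\<And>X. orthonormal X \<Longrightarrow> B \<subseteq> X \<Longrightarrow> X = B"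
    by blast
  have "uncountable B"
  proof
    assume count: "countable B"
    define A where "A n = {e\<in>B. to_nat_on B e < n}" for n
    have "finite (A n)" for n
    proof (rule finite_imageD)
      show "finite (to_nat_on B ` A n)"
        by (rule finite_subset [of _ "{..<n}"]) (auto simp: A_def)
      show "inj_on (to_nat_on B) (A n)"
        using inj_on_to_nat_on [OF count] by (rule inj_on_subset) (auto simp: A_def)
    qed
    then have A: "incseq A" "\<And>n. finite (A n)" "\<And>n. A n \<subseteq> B"
      by (auto simp: A_def intro!: monoI)
    define g where "g n c = (\<Sum>e\<in>A n. c (to_nat_on B e) *\<^sub>R e)" for n and c :: "nat \<Rightarrow> real"
    obtain Q :: "(nat \<Rightarrow> real) set" where Q: "countable Q" "\<And>U. open U \<Longrightarrow> U \<noteq> {} \<Longrightarrow> \<exists>d\<in>Q. d \<in> U"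
      using countable_dense_exists by blast
    have closQ: "closure Q = UNIV"
    proof (intro equalityI subset_UNIV subsetI)
      fix c :: "nat \<Rightarrow> real"
      have "Q \<inter> U \<noteq> {}" if "open U" "c \<in> U" for U
        using Q(2) [OF that(1)] that(2) by auto
      then show "c \<in> closure Q"
        unfolding closure_iff_nhds_not_empty by blast
    qed
    define D where "D = (\<Union>n. g n ` Q)"
    have gD: "g n c \<in> closure D" for n c
    proof -
      have "continuous_on (closure Q) (g n)"
        unfolding g_def [abs_def]
        by (intro continuous_intros continuous_on_product_coordinates [THEN continuous_on_subset]) auto
      then have "g n ` closure Q \<subseteq> closure D"
        by (rule image_closure_subset) (use closure_subset [of D] in \<open>auto simp: D_def\<close>)
      then show ?thesis
        by (auto simp: closQ)
    qed
    have "x \<in> closure D" for x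
    proof -
      obtain s where s: "(\<lambda>n. \<Sum>e\<in>A n. (x \<bullet> e) *\<^sub>R e) \<longlonglongrightarrow> s"
        and sx: "\<And>n e. e \<in> A n \<Longrightarrow> s \<bullet> e = x \<bullet> e"
        using orthonormal_expansion_converges [OF B A] by blast
      have perp: "(x - s) \<bullet> e = 0" if "e \<in> B" for e
        using sx [of e "Suc (to_nat_on B e)"] that by (simp add: A_def inner_diff_left)
      have "x = s"
      proof (rule ccontr)
        assume "x \<noteq> s"
        define y where "y = (x - s) /\<^sub>R norm (x - s)"
        have y: "norm y = 1" "\<And>e. e \<in> B \<Longrightarrow> y \<bullet> e = 0"
          using \<open>x \<noteq> s\<close> perp by (auto simp: y_def)
        then have "orthonormal (insert y B)"
          using B by (auto simp: orthonormal_def pairwise_insert orthogonal_def inner_commute)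
        then have "y \<in> B"
          using max by blast
        then show False
          using y by (metis norm_eq_zero inner_eq_zero_iff zero_neq_one)
      qed
      moreover have "(\<Sum>e\<in>A n. (x \<bullet> e) *\<^sub>R e) \<in> closure D" for n
      proof -
        have "(\<Sum>e\<in>A n. (x \<bullet> e) *\<^sub>R e) = g n (\<lambda>i. x \<bullet> from_nat_into B i)"
          unfolding g_def using count by (intro sum.cong) (auto simp: A_def)
        then show ?thesis by (simp add: gD)
      qed
      ultimately show ?thesis
        using s closed_sequentially [OF closed_closure, of "\<lambda>n. \<Sum>e\<in>A n. (x \<bullet> e) *\<^sub>R e" D s]
        by simp
    qed
    moreover have "countable D"
      using Q(1) by (auto simp: D_def)
    ultimately have "separable_space (euclidean :: 'h topology)"
      unfolding separable_space_def by (intro exI [of _ D]) auto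
    with nonsep show False ..
  qed
  with B show thesis by (rule that)
qed

section \<open>Weak convergence\<close>

lemma limitin_weak_topology:
  "limitin weak_topology f l F \<longleftrightarrow> (\<forall>g :: 'a::real_normed_vector \<Rightarrow>\<^sub>L real. ((\<lambda>i. g (f i)) \<longlongrightarrow> g l) F)"
  (is "?L \<longleftrightarrow> ?R")
proof
  assume L: ?L
  show ?R
    using continuous_map_limit [OF continuous_map_weak_topology_blinfun L]
    by (simp add: o_def)
next
  assume R: ?R
  then have lim: "limitin euclidean (\<lambda>i (g :: 'a \<Rightarrow>\<^sub>L real). g (f i)) (\<lambda>g. g l) F"
    by (simp add: limitin_componentwise flip: euclidean_product_topology)
  show ?L
    unfolding limitin_def
  proof (intro conjI allI impI)
    fix U assume "openin weak_topology U \<and> l \<in> U"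
    then obtain V where V: "open V" "U = (\<lambda>x (g :: 'a \<Rightarrow>\<^sub>L real). g x) -` V" "l \<in> U"
      by (auto simp: weak_topology_def openin_pullback_topology)
    then show "\<forall>\<^sub>F i in F. f i \<in> U"
      using lim by (auto simp: limitin_def)
  qed simp
qed

text \<open>The squares of the values of a functional on an orthonormal sequence are summable.\<close>

lemma orthonormal_sequence_weak_null:
  fixes f :: "'a::real_inner \<Rightarrow>\<^sub>L real"
  assumes "orthonormal B" "inj s" "range s \<subseteq> B"
  shows "(\<lambda>k. f (s k)) \<longlonglongrightarrow> 0"
proof -
  have "summable (\<lambda>k. (f (s k))\<^sup>2)"
  proof (rule summableI_nonneg_bounded)
    fix n :: nat
    have inj: "inj_on s {..<n}"
      using assms(2) by (rule inj_on_subset) simp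
    have "orthonormal (s ` {..<n})"
      using assms(1) by (rule orthonormal_subset) (use assms(3) in auto)
    then have "(\<Sum>e\<in>s ` {..<n}. (f e)\<^sup>2) \<le> (norm f)\<^sup>2"
      using norm_blinfun [of f]
      by (intro Bessel_functional)
        (auto simp: blinfun.bounded_linear_right bounded_linear.linear)
    then show "(\<Sum>k<n. (f (s k))\<^sup>2) \<le> (norm f)\<^sup>2"
      by (simp add: sum.reindex [OF inj])
  qed simp
  then have "(\<lambda>k. (f (s k))\<^sup>2) \<longlonglongrightarrow> 0"
    by (rule summable_LIMSEQ_zero)
  then show ?thesis
    by (simp add: tendsto_null_power)
qed

text \<open>Infinitely many such directions \<open>e\<close> would contain a sequence along which \<open>x + t *\<^sub>R e\<close> tends
  weakly to \<open>x\<close>, contradicting continuity of \<open>g\<close> at \<open>x\<close>.\<close>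

lemma finite_weakly_sensitive_directions:
  assumes B: "orthonormal B" and g: "continuous_map (weak_ball r) euclideanreal g"
    and x: "x \<in> cball 0 r" and \<epsilon>: "0 < \<epsilon>"
  shows "finite {e\<in>B. x + t *\<^sub>R e \<in> cball 0 r \<and> \<epsilon> \<le> \<bar>g (x + t *\<^sub>R e) - g x\<bar>}" (is "finite ?D")
proof (rule ccontr)
  assume "infinite ?D"
  then obtain s :: "nat \<Rightarrow> 'a" where s: "inj s" "range s \<subseteq> ?D"
    using infinite_countable_subset by blast
  have "(\<lambda>k. f (x + t *\<^sub>R s k)) \<longlonglongrightarrow> f x" for f :: "'a \<Rightarrow>\<^sub>L real"
  proof -
    have "(\<lambda>k. f (s k)) \<longlonglongrightarrow> 0"
      using s by (intro orthonormal_sequence_weak_null [OF B]) auto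
    then have "(\<lambda>k. f x + t * f (s k)) \<longlonglongrightarrow> f x + t * 0"
      by (intro tendsto_intros)
    then show ?thesis
      by (simp add: blinfun.add_right blinfun.scaleR_right)
  qed
  then have "limitin (weak_ball r) (\<lambda>k. x + t *\<^sub>R s k) x sequentially"
    using s x by (auto simp: weak_ball_def limitin_subtopology limitin_weak_topology image_subset_iff
        simp del: mem_cball_0)
  then have "(\<lambda>k. g (x + t *\<^sub>R s k)) \<longlonglongrightarrow> g x"
    using continuous_map_limit [OF g] by (fastforce simp: o_def)
  then obtain k where "\<bar>g (x + t *\<^sub>R s k) - g x\<bar> < \<epsilon>"
    using \<epsilon> by (auto simp: LIMSEQ_iff)
  moreover have "s k \<in> ?D"
    using s by auto
  ultimately show False by auto
qed

section \<open>Selecting directions\<close>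

text \<open>In the two lemmas of this part, \<open>G S A\<close> stands for the value at the point \<open>x\<^sub>A\<close> of a function
  \<open>T f\<^sub>S\<close>.

  A countable set has only countably many pairs of finite subsets, and each pair excludes only
  countably many directions. So after any countable part of \<open>B\<close> there is still room
  for an infinite layer that avoids all directions to which some pair reacts.\<close>

lemma uncountable_layers:
  fixes G :: "'a set \<Rightarrow> 'a set \<Rightarrow> real"
  assumes B: "uncountable B"
    and fin: "\<And>S A \<epsilon>. \<lbrakk>S \<subseteq> B; A \<subseteq> B; finite S; finite A; card A < n; 0 < \<epsilon>\<rbrakk>
      \<Longrightarrow> finite {e\<in>B. \<epsilon> \<le> \<bar>G S (insert e A) - G S A\<bar>}"
  obtains X :: "nat \<Rightarrow> 'a set"
  where "\<And>i. X i \<subseteq> B" "\<And>i. infinite (X i)" "\<And>i j. j < i \<Longrightarrow> X i \<inter> X j = {}"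
    and "\<And>i S A e. \<lbrakk>finite S; S \<subseteq> (\<Union>j<i. X j); finite A; A \<subseteq> (\<Union>j<i. X j); card A < n; e \<in> X i\<rbrakk>
      \<Longrightarrow> G S (insert e A) = G S A"
proof -
  define bad where "bad S A = {e\<in>B. G S (insert e A) \<noteq> G S A}" for S A
  have bad: "countable (bad S A)" if "S \<subseteq> B" "A \<subseteq> B" "finite S" "finite A" "card A < n" for S A
  proof -
    have "bad S A = (\<Union>k. {e\<in>B. 1 / Suc k \<le> \<bar>G S (insert e A) - G S A\<bar>})"
    proof (intro equalityI subsetI)
      fix e assume "e \<in> bad S A"
      then have "e \<in> B" "0 < \<bar>G S (insert e A) - G S A\<bar>"
        by (auto simp: bad_def)
      moreover from this obtain k :: nat where "1 / Suc k < \<bar>G S (insert e A) - G S A\<bar>"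
        using nat_approx_posE by blast
      ultimately show "e \<in> (\<Union>k. {e\<in>B. 1 / Suc k \<le> \<bar>G S (insert e A) - G S A\<bar>})"
        by (intro UN_I [of k]) auto
    next
      fix e assume "e \<in> (\<Union>k. {e\<in>B. 1 / Suc k \<le> \<bar>G S (insert e A) - G S A\<bar>})"
      then obtain k :: nat where k: "e \<in> B" "1 / Suc k \<le> \<bar>G S (insert e A) - G S A\<bar>"
        by auto
      moreover have "0 < 1 / real (Suc k)" by simp
      ultimately have "0 < \<bar>G S (insert e A) - G S A\<bar>" by linarith
      with k(1) show "e \<in> bad S A"
        unfolding bad_def by auto
    qed
    also have "countable \<dots>"
      by (intro countable_UN [OF countableI_type] countable_finite fin that) auto
    finally show ?thesis .
  qed
  define P where "P X i Y \<longleftrightarrow> Y \<subseteq> B \<and> countable Y \<and> infinite Y \<and> Y \<inter> (\<Union>j<i. X j) = {} \<and>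
      (\<forall>S A. finite S \<and> S \<subseteq> (\<Union>j<i. X j) \<and> finite A \<and> A \<subseteq> (\<Union>j<i. X j) \<and> card A < n
        \<longrightarrow> Y \<inter> bad S A = {})" for X :: "nat \<Rightarrow> 'a set" and i Y
  have "\<exists>X. \<forall>i. P X i (X i)"
  proof (rule dependent_wellorder_choice)
    fix Y f g and i :: nat
    assume "\<And>j. j < i \<Longrightarrow> f j = (g j :: 'a set)"
    then have "(\<Union>j<i. f j) = (\<Union>j<i. g j)" by auto
    then show "P f i Y = P g i Y" by (simp only: P_def)
  next
    fix i and X :: "nat \<Rightarrow> 'a set"
    assume IH: "\<And>j. j < i \<Longrightarrow> P X j (X j)"
    define Z where "Z = (\<Union>j<i. X j)"
    define W where "W = (\<Union>S\<in>{S. finite S \<and> S \<subseteq> Z}. \<Union>A\<in>{A. finite A \<and> A \<subseteq> Z \<and> card A < n}. bad S A)"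
    have "X j \<subseteq> B \<and> countable (X j)" if "j < i" for j
      using IH [OF that] by (simp add: P_def)
    then have Z: "countable Z" "Z \<subseteq> B"
      by (auto simp: Z_def)
    have "countable {A. finite A \<and> A \<subseteq> Z}"
      using Z(1) by (rule countable_Collect_finite_subset)
    moreover from this have "countable {A. finite A \<and> A \<subseteq> Z \<and> card A < n}"
      by (rule countable_subset [rotated]) auto
    ultimately have "countable W"
      unfolding W_def using Z(2) by (intro countable_UN bad) auto
    then have "uncountable (B - (Z \<union> W))"
      using B Z(1) by (intro uncountable_minus_countable) auto
    then obtain Y where "Y \<subseteq> B - (Z \<union> W)" "countable Y" "infinite Y"
      using countable_finite infinite_countable_subset' by metis
    moreover from this have "Y \<inter> bad S A = {}"
      if "finite S" "S \<subseteq> Z" "finite A" "A \<subseteq> Z" "card A < n" for S A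
      using that by (fastforce simp: W_def)
    ultimately have "P X i Y"
      unfolding P_def Z_def [symmetric] by blast
    then show "\<exists>Y. P X i Y" ..
  qed
  then obtain X where X: "\<And>i. P X i (X i)" by blast
  show thesis
  proof
    show "X i \<subseteq> B" "infinite (X i)" for i
      using X [of i] by (auto simp: P_def)
    show "X i \<inter> X j = {}" if "j < i" for i j
      using X [of i] that by (auto simp: P_def)
    show "G S (insert e A) = G S A"
      if "finite S" "S \<subseteq> (\<Union>j<i. X j)" "finite A" "A \<subseteq> (\<Union>j<i. X j)" "card A < n" "e \<in> X i" for i S A e
      using X [of i] that unfolding P_def bad_def by blast
  qed
qed

text \<open>A term above the window \<open>{i..<j}\<close> is irrelevant because its layer comes later, a term below
  it because it was chosen later. A term between two elements of a set \<open>S\<close> would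
  have to come both before and after elements of \<open>S\<close>, so this argument is confined to windows.\<close>

lemma nearly_free_sequence:
  fixes G :: "'a set \<Rightarrow> 'a set \<Rightarrow> real"
  assumes B: "uncountable B"
    and fin: "\<And>S A \<epsilon>. \<lbrakk>S \<subseteq> B; A \<subseteq> B; finite S; finite A; card A < n; 0 < \<epsilon>\<rbrakk>
      \<Longrightarrow> finite {e\<in>B. \<epsilon> \<le> \<bar>G S (insert e A) - G S A\<bar>}"
    and \<delta>: "0 < \<delta>"
  obtains a :: "nat \<Rightarrow> 'a"
  where "inj_on a {..<n}" "a ` {..<n} \<subseteq> B"
    and "\<And>i j. i \<le> j \<Longrightarrow> j \<le> n \<Longrightarrow>
      \<bar>G (a ` {i..<j}) (a ` {..<n}) - G (a ` {i..<j}) (a ` {i..<j})\<bar> \<le> real n * \<delta>"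
proof -
  obtain X where XB: "\<And>i. X i \<subseteq> B" and Xinf: "\<And>i::nat. infinite (X i)"
    and Xdisj: "\<And>i j. j < i \<Longrightarrow> X i \<inter> X j = {}"
    and Xfree: "\<And>i S A e. \<lbrakk>finite S; S \<subseteq> (\<Union>j<i. X j); finite A; A \<subseteq> (\<Union>j<i. X j); card A < n; e \<in> X i\<rbrakk>
      \<Longrightarrow> G S (insert e A) = G S A"
  proof (rule uncountable_layers [OF B, of n G], goal_cases)
    case 1
    show ?case by (rule fin) (fact 1)+
  next
    case (2 X)
    show ?case by (rule 2(1) [OF 2(2-5)])
  qed
  \<comment> \<open>The sequence is chosen from the top layer \<open>X (n - 1)\<close> downwards, so \<open>b k\<close> will be
    \<open>a (n - 1 - k)\<close>; each choice avoids the finitely many directions that matter to the earlier ones.\<close>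
  define P where "P b k e \<longleftrightarrow> e \<in> X (n - Suc k) \<and>
      (\<forall>S A. S \<subseteq> b ` {..<k} \<and> A \<subseteq> b ` {..<k} \<and> card A < n \<longrightarrow> \<bar>G S (insert e A) - G S A\<bar> < \<delta>)"
    for b and k :: nat and e
  have "\<exists>b. \<forall>k. P b k (b k)"
  proof (rule dependent_wellorder_choice)
    fix e f g and k :: nat
    assume "\<And>j. j < k \<Longrightarrow> f j = (g j :: 'a)"
    then have "f ` {..<k} = g ` {..<k}" by auto
    then show "P f k e = P g k e" by (simp only: P_def)
  next
    fix k and b :: "nat \<Rightarrow> 'a"
    assume IH: "\<And>j. j < k \<Longrightarrow> P b j (b j)"
    define Z where "Z = b ` {..<k}"
    have "b j \<in> B" if "j < k" for j
      using IH [OF that] XB by (auto simp: P_def)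
    then have Z: "finite Z" "Z \<subseteq> B"
      by (auto simp: Z_def)
    define W where "W = (\<Union>S\<in>Pow Z. \<Union>A\<in>{A\<in>Pow Z. card A < n}. {e\<in>B. \<delta> \<le> \<bar>G S (insert e A) - G S A\<bar>})"
    have "finite W"
      unfolding W_def using Z \<delta> by (intro finite_UN_I fin) (auto intro: finite_subset)
    then have "\<not> X (n - Suc k) \<subseteq> W"
      using Xinf [of "n - Suc k"] finite_subset by blast
    then obtain e where e: "e \<in> X (n - Suc k)" "e \<notin> W"
      by blast
    have "\<bar>G S (insert e A) - G S A\<bar> < \<delta>" if "S \<subseteq> Z" "A \<subseteq> Z" "card A < n" for S A
    proof (rule ccontr)
      assume "\<not> ?thesis"
      then have "e \<in> {e\<in>B. \<delta> \<le> \<bar>G S (insert e A) - G S A\<bar>}"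
        using e(1) XB by auto
      with that e(2) show False
        unfolding W_def by blast
    qed
    with e(1) have "P b k e"
      unfolding P_def Z_def by blast
    then show "\<exists>e. P b k e" ..
  qed
  then obtain b where b: "\<And>k. P b k (b k)" by blast
  define a where "a i = b (n - Suc i)" for i
  have aX: "a i \<in> X i" if "i < n" for i
    using b [of "n - Suc i"] that by (auto simp: P_def a_def Suc_diff_Suc)
  have a_step: "\<bar>G S (insert (a i) A) - G S A\<bar> < \<delta>"
    if "i < n" "S \<subseteq> a ` {Suc i..<n}" "A \<subseteq> a ` {Suc i..<n}" "card A < n" for i S A
  proof -
    have "a ` {Suc i..<n} \<subseteq> b ` {..<n - Suc i}"
      by (auto simp: a_def)
    then have "S \<subseteq> b ` {..<n - Suc i}" "A \<subseteq> b ` {..<n - Suc i}"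
      using that(2,3) by blast+
    moreover have "\<forall>S A. S \<subseteq> b ` {..<n - Suc i} \<and> A \<subseteq> b ` {..<n - Suc i} \<and> card A < n
        \<longrightarrow> \<bar>G S (insert (a i) A) - G S A\<bar> < \<delta>"
      using b [of "n - Suc i"] unfolding P_def a_def [of i] by (rule conjunct2)
    ultimately show ?thesis
      using that(4) by blast
  qed
  have inj: "inj_on a {..<n}"
  proof (rule inj_onI, rule ccontr)
    fix i j assume "i \<in> {..<n}" "j \<in> {..<n}" "a i = a j" "i \<noteq> j"
    then show False
      using aX [of i] aX [of j] Xdisj [of i j] Xdisj [of j i] by (auto simp: neq_iff)
  qed
  \<comment> \<open>Dropping the terms below a window one at a time, the lowest first, costs less than \<open>\<delta>\<close> each.\<close>
  have lower: "\<bar>G S (a ` {..<n}) - G S (a ` {l..<n})\<bar> \<le> real l * \<delta>"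
    if "l \<le> i" "i \<le> n" "S \<subseteq> a ` {i..<n}" for l i S
    using that(1)
  proof (induction l)
    case 0
    then show ?case by (simp add: lessThan_atLeast0)
  next
    case (Suc l)
    have "card (a ` {Suc l..<n}) < n"
      using card_image_le [of "{Suc l..<n}" a] Suc.prems that(2) by simp
    moreover have "S \<subseteq> a ` {Suc l..<n}"
      using that(3) Suc.prems by fastforce
    ultimately have "\<bar>G S (insert (a l) (a ` {Suc l..<n})) - G S (a ` {Suc l..<n})\<bar> < \<delta>"
      using Suc.prems that(2) by (intro a_step) auto
    moreover have "insert (a l) (a ` {Suc l..<n}) = a ` {l..<n}"
    proof -
      have "{l..<n} = insert l {Suc l..<n}"
        using Suc.prems that(2) by auto
      then show ?thesis by simp
    qed
    ultimately show ?case
      using Suc by (auto simp: algebra_simps)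
  qed
  \<comment> \<open>Dropping the terms above a window, the highest first, costs nothing: each lies in a layer
    above everything that remains.\<close>
  have upper: "G (a ` {i..<j}) (a ` {i..<r}) = G (a ` {i..<j}) (a ` {i..<j})"
    if "i \<le> j" "j \<le> r" "r \<le> n" for i j r
    using that(2,3)
  proof (induction r rule: dec_induct)
    case (step r)
    have "card (a ` {i..<r}) < n"
      using card_image_le [of "{i..<r}" a] step by simp
    moreover have "a l \<in> (\<Union>k<r. X k)" if "l < r" for l
      using aX [of l] that step by auto
    then have "a ` {i..<r} \<subseteq> (\<Union>k<r. X k)" "a ` {i..<j} \<subseteq> (\<Union>k<r. X k)"
      using step.hyps by auto
    ultimately have "G (a ` {i..<j}) (insert (a r) (a ` {i..<r})) = G (a ` {i..<j}) (a ` {i..<r})"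
      using step aX by (intro Xfree [where i = r]) auto
    moreover have "insert (a r) (a ` {i..<r}) = a ` {i..<Suc r}"
      using step that(1) by (simp add: atLeastLessThanSuc)
    ultimately show ?case
      using step by simp
  qed simp
  show thesis
  proof
    show "a ` {..<n} \<subseteq> B"
      using aX XB by blast
    fix i j assume ij: "i \<le> j" "j \<le> n"
    have "\<bar>G (a ` {i..<j}) (a ` {..<n}) - G (a ` {i..<j}) (a ` {i..<n})\<bar> \<le> real i * \<delta>"
      using ij by (intro lower [where i = i]) auto
    also have "\<dots> \<le> real n * \<delta>"
      using ij \<delta> by simp
    finally show "\<bar>G (a ` {i..<j}) (a ` {..<n}) - G (a ` {i..<j}) (a ` {i..<j})\<bar> \<le> real n * \<delta>"
      using upper [of i j n] ij by simp
  qed (fact inj)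
qed

section \<open>Spaces of continuous functions\<close>

lemma C_spaceI:
  assumes "f \<in> extensional (topspace X)" "continuous_map X euclideanreal f"
    and "\<And>x. x \<in> topspace X \<Longrightarrow> \<bar>f x\<bar> \<le> K"
  shows "f \<in> C_space X"
proof -
  have "bounded (f ` topspace X)"
    using assms(3) by (auto simp: bounded_iff)
  then show ?thesis
    using assms(1,2) by (auto simp: C_space_def)
qed

lemma abs_le_sup_norm:
  assumes "f \<in> C_space X" "x \<in> topspace X"
  shows "\<bar>f x\<bar> \<le> sup_norm X f"
proof -
  have "continuous_map X euclideanreal (\<lambda>x\<in>topspace X. 0)"
    by (rule continuous_map_eq [where f = "\<lambda>x. 0"]) auto
  then have zero: "(\<lambda>x\<in>topspace X. 0) \<in> C_space X"
    by (intro C_spaceI [where K = 0]) auto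
  have "topspace X \<noteq> {}"
    using assms(2) by blast
  from cfunspace_mdist_le [OF assms(1) [unfolded C_space_def] zero [unfolded C_space_def] this]
  have "\<forall>x\<in>topspace X. mdist euclidean_metric (f x) ((\<lambda>x\<in>topspace X. 0) x) \<le> sup_norm X f"
    unfolding sup_norm_def by blast
  with assms(2) show ?thesis
    by (auto simp: dist_real_def)
qed

lemma C_space_continuous_map: "f \<in> C_space X \<Longrightarrow> continuous_map X euclideanreal f"
  by (simp add: C_space_def)

lemma C_space_extensional: "f \<in> C_space X \<Longrightarrow> f \<in> extensional (topspace X)"
  by (simp add: C_space_def)

lemma C_space_add:
  assumes "f \<in> C_space X" "g \<in> C_space X"
  shows "(\<lambda>x\<in>topspace X. f x + g x) \<in> C_space X"
proof (rule C_spaceI)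
  show "continuous_map X euclideanreal (\<lambda>x\<in>topspace X. f x + g x)"
    by (rule continuous_map_eq [OF continuous_map_add
          [OF assms(1) [THEN C_space_continuous_map] assms(2) [THEN C_space_continuous_map]]]) simp
  show "\<bar>(\<lambda>x\<in>topspace X. f x + g x) x\<bar> \<le> sup_norm X f + sup_norm X g" if "x \<in> topspace X" for x
    using abs_le_sup_norm [OF assms(1) that] abs_le_sup_norm [OF assms(2) that] that by simp
qed auto

lemma bounded_linear_operator_sum:
  assumes T: "bounded_linear_operator X Y T"
    and I: "finite I" "I \<noteq> {}" "\<And>i. i \<in> I \<Longrightarrow> f i \<in> C_space X"
  shows "(\<lambda>x\<in>topspace X. \<Sum>i\<in>I. f i x) \<in> C_space X \<and>
    T (\<lambda>x\<in>topspace X. \<Sum>i\<in>I. f i x) = (\<lambda>y\<in>topspace Y. \<Sum>i\<in>I. T (f i) y)"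
  using I
proof (induction I rule: finite_ne_induct)
  case (singleton i)
  then have "T (f i) \<in> C_space Y"
    using T by (auto simp: bounded_linear_operator_def)
  with singleton show ?case
    by (simp add: extensional_restrict C_space_extensional)
next
  case (insert i I)
  let ?S = "\<lambda>x\<in>topspace X. \<Sum>i\<in>I. f i x"
  have eq: "(\<lambda>x\<in>topspace X. \<Sum>i\<in>insert i I. f i x) = (\<lambda>x\<in>topspace X. f i x + ?S x)"
    using insert.hyps by (auto simp: fun_eq_iff)
  have fi: "f i \<in> C_space X"
    using insert.prems by simp
  have "?S \<in> C_space X \<and> T ?S = (\<lambda>y\<in>topspace Y. \<Sum>i\<in>I. T (f i) y)"
    by (rule insert.IH) (simp add: insert.prems)
  then have S: "?S \<in> C_space X" and TS: "T ?S = (\<lambda>y\<in>topspace Y. \<Sum>i\<in>I. T (f i) y)"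
    by blast+
  have "T (\<lambda>x\<in>topspace X. f i x + ?S x) = (\<lambda>y\<in>topspace Y. T (f i) y + T ?S y)"
    using T fi S unfolding bounded_linear_operator_def by blast
  also have "\<dots> = (\<lambda>y\<in>topspace Y. \<Sum>i\<in>insert i I. T (f i) y)"
    using insert.hyps unfolding TS by (intro restrict_ext) simp
  finally show ?case
    unfolding eq using C_space_add [OF fi S] by (intro conjI)
qed

section \<open>Bumps with disjoint supports\<close>

text \<open>The piecewise linear function that is \<open>0\<close> up to \<open>s\<close> and \<open>1\<close> from \<open>t\<close> on, where \<open>s < t\<close>.\<close>

definition ramp :: "real \<Rightarrow> real \<Rightarrow> real \<Rightarrow> real" where
  "ramp s t x = max 0 (min 1 ((x - s) / (t - s)))"

definition bump :: "real \<Rightarrow> real \<Rightarrow> 'a::real_inner set \<Rightarrow> 'a \<Rightarrow> real" where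
  "bump s t S y = (\<Prod>e\<in>S. ramp s t (y \<bullet> e))"

lemma bump_bounds: "0 \<le> bump s t S y" "bump s t S y \<le> 1"
  unfolding bump_def ramp_def by (auto intro!: prod_nonneg prod_le_1)

lemma bump_continuous:
  assumes "finite S"
  shows "continuous_map (weak_ball r) euclideanreal (bump s t S)"
proof -
  have "continuous_map (weak_ball r) euclideanreal (\<lambda>y. ramp s t (y \<bullet> e))" for e :: 'a
  proof -
    have "continuous_map (weak_ball r) euclideanreal (\<lambda>y. y \<bullet> e)"
      using continuous_map_weak_topology_blinfun [of "blinfun_inner_left e"]
      by (simp add: weak_ball_def continuous_map_from_subtopology inner_commute)
    moreover have "continuous_map euclideanreal euclideanreal (ramp s t)"
      unfolding ramp_def [abs_def] divide_inverse continuous_map_iff_continuous2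
      by (intro continuous_intros)
    ultimately have "continuous_map (weak_ball r) euclideanreal (ramp s t \<circ> (\<lambda>y. y \<bullet> e))"
      by (rule continuous_map_compose)
    then show ?thesis
      by (simp add: o_def)
  qed
  then show ?thesis
    unfolding bump_def [abs_def] using assms by (intro continuous_map_prod) auto
qed

text \<open>Where both bumps are nonzero, the at least \<open>m + 1\<close> coordinates in \<open>S \<union> S'\<close> all exceed \<open>s\<close>, which
  by Bessel's inequality forces a norm greater than \<open>r\<close>.\<close>

lemma bumps_disjoint:
  assumes B: "orthonormal B" and S: "S \<subseteq> B" "S' \<subseteq> B" "finite S" "finite S'"
    and card: "card S = m" "card S' = m" "S \<noteq> S'"
    and s: "0 \<le> s" "s < t" "r\<^sup>2 \<le> (real m + 1) * s\<^sup>2" and y: "norm y \<le> r"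
  shows "bump s t S y = 0 \<or> bump s t S' y = 0"
proof (rule ccontr)
  assume "\<not> ?thesis"
  then have "ramp s t (y \<bullet> e) \<noteq> 0" if "e \<in> S \<union> S'" for e
    using that S by (auto simp: bump_def)
  moreover have "ramp s t c = 0" if "c \<le> s" for c
    using that s by (simp add: ramp_def divide_le_0_iff)
  ultimately have gt: "s < y \<bullet> e" if "e \<in> S \<union> S'" for e
    using that not_less by blast
  have "S \<subset> S \<union> S'"
    using card S card_subset_eq [of S S'] by (metis Un_upper1 psubsetI sup.orderI)
  then have c: "m + 1 \<le> card (S \<union> S')"
    using psubset_card_mono [of "S \<union> S'" S] S card by simp
  have ne: "S \<union> S' \<noteq> {}"
    using card by auto
  have "r\<^sup>2 \<le> real (card (S \<union> S')) * s\<^sup>2"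
    using s(3) c mult_right_mono [of "real m + 1" "card (S \<union> S')" "s\<^sup>2"] by simp
  also have "\<dots> = (\<Sum>e\<in>S \<union> S'. s\<^sup>2)"
    by simp
  also have "\<dots> < (\<Sum>e\<in>S \<union> S'. (y \<bullet> e)\<^sup>2)"
    using gt s S ne by (intro sum_strict_mono power_strict_mono) auto
  also have "\<dots> \<le> (norm y)\<^sup>2"
    using S B by (intro Bessel) (auto intro: orthonormal_subset)
  also have "\<dots> \<le> r\<^sup>2"
    using y by (simp add: power_mono)
  finally show False by simp
qed

section \<open>Nonexistence of extension operators\<close>

theorem theorem1p2:
  fixes \<kappa> \<mu> :: real
  assumes "\<not> separable_space (euclidean :: 'h::{real_inner, complete_space} topology)"
    and "0 < \<kappa>" and "\<kappa> < \<mu>"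
  shows "\<nexists>T. extension_operator (weak_ball \<mu> :: 'h topology) (cball 0 \<kappa>) T"
proof
  assume "\<exists>T. extension_operator (weak_ball \<mu> :: 'h topology) (cball 0 \<kappa>) T"
  then obtain T where T: "bounded_linear_operator (weak_ball \<kappa> :: 'h topology) (weak_ball \<mu>) T"
    and ext: "\<And>f. f \<in> C_space (weak_ball \<kappa>) \<Longrightarrow> restrict (T f) (cball 0 \<kappa>) = f"
    using assms(3) by (auto simp: extension_operator_def subtopology_weak_ball)
  have top: "topspace (weak_ball r :: 'h topology) = cball 0 r" for r
    by (simp add: weak_ball_def)
  have TC: "T f \<in> C_space (weak_ball \<mu>)" if "f \<in> C_space (weak_ball \<kappa>)" for f
    using T that by (auto simp: bounded_linear_operator_def)
  obtain M where M: "\<And>f. f \<in> C_space (weak_ball \<kappa>) \<Longrightarrow>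
      sup_norm (weak_ball \<mu>) (T f) \<le> M * sup_norm (weak_ball \<kappa>) f"
    using T unfolding bounded_linear_operator_def by blast
  obtain B :: "'h set" where B: "orthonormal B" "uncountable B"
    using uncountable_orthonormal_set [OF assms(1)] .
  obtain k :: nat where k: "2 * \<bar>M\<bar> < real k"
    using reals_Archimedean2 by blast
  \<comment> \<open>Large \<open>m\<close> makes room for \<open>m + k\<close> orthogonal steps of length \<open>\<kappa> / sqrt m\<close> in the large ball.\<close>
  have gap: "0 < \<mu>\<^sup>2 - \<kappa>\<^sup>2"
    using assms(2,3) by (simp add: power_strict_mono)
  obtain m :: nat where m: "real k * \<kappa>\<^sup>2 / (\<mu>\<^sup>2 - \<kappa>\<^sup>2) < real m"
    using reals_Archimedean2 by blast
  have "0 \<le> real k * \<kappa>\<^sup>2 / (\<mu>\<^sup>2 - \<kappa>\<^sup>2)"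
    using gap by simp
  with m have m0: "0 < m" by simp
  define n where "n = m + k"
  \<comment> \<open>The bumps rise from \<open>0\<close> at \<open>s\<close> to \<open>1\<close> at \<open>t\<close>: the small ball has room for \<open>m\<close> coordinates equal
    to \<open>t\<close>, but not for \<open>m + 1\<close> coordinates greater than \<open>s\<close>.\<close>
  define t where "t = \<kappa> / sqrt m"
  define s where "s = \<kappa> / sqrt (real m + 1)"
  have t2: "real m * t\<^sup>2 = \<kappa>\<^sup>2"
    using m0 by (simp add: t_def power_divide)
  have s2: "(real m + 1) * s\<^sup>2 = \<kappa>\<^sup>2"
    by (simp add: s_def power_divide field_simps)
  have s: "0 \<le> s" "s < t"
    using m0 assms(2) by (auto simp: s_def t_def intro!: divide_strict_left_mono)
  have "real n * t\<^sup>2 \<le> \<mu>\<^sup>2"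
  proof -
    have "real k * t\<^sup>2 * real m = real k * \<kappa>\<^sup>2"
      using t2 by (simp add: algebra_simps)
    also have "\<dots> \<le> (\<mu>\<^sup>2 - \<kappa>\<^sup>2) * real m"
      using m gap by (simp add: pos_divide_less_eq mult.commute)
    finally have "real k * t\<^sup>2 \<le> \<mu>\<^sup>2 - \<kappa>\<^sup>2"
      using m0 by simp
    then show ?thesis
      using t2 by (simp add: n_def algebra_simps)
  qed
  then have in_ball: "t *\<^sub>R \<Sum>A \<in> cball 0 \<mu>" if "A \<subseteq> B" "finite A" "card A \<le> n" for A
  proof -
    have "(norm (t *\<^sub>R \<Sum>A))\<^sup>2 = real (card A) * t\<^sup>2"
      using B(1) that by (intro norm_scaled_sum_orthonormal orthonormal_subset [OF B(1)])
    also have "\<dots> \<le> real n * t\<^sup>2"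
      using that by (intro mult_right_mono) auto
    finally have "(norm (t *\<^sub>R \<Sum>A))\<^sup>2 \<le> \<mu>\<^sup>2"
      using \<open>real n * t\<^sup>2 \<le> \<mu>\<^sup>2\<close> by linarith
    then show ?thesis
      using assms(2,3) power2_le_imp_le [of "norm (t *\<^sub>R \<Sum>A)" \<mu>] by simp
  qed
  define f where "f S = restrict (bump s t S) (cball 0 \<kappa>)" for S :: "'h set"
  have fC: "f S \<in> C_space (weak_ball \<kappa>)" if "finite S" for S
  proof (rule C_spaceI)
    show "continuous_map (weak_ball \<kappa>) euclideanreal (f S)"
      by (rule continuous_map_eq [OF bump_continuous [OF that]]) (simp add: f_def top)
    show "\<bar>f S x\<bar> \<le> 1" if "x \<in> topspace (weak_ball \<kappa>)" for x
      using that bump_bounds [of s t S x] by (simp add: f_def top)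
  qed (simp add: f_def top)
  define G where "G S A = T (f S) (t *\<^sub>R \<Sum>A)" for S A
  have fin: "finite {e\<in>B. \<epsilon> \<le> \<bar>G S (insert e A) - G S A\<bar>}"
    if "S \<subseteq> B" "A \<subseteq> B" "finite S" "finite A" "card A < n" "0 < \<epsilon>" for S A \<epsilon>
  proof -
    let ?x = "t *\<^sub>R \<Sum>A"
    let ?D = "{e\<in>B. ?x + t *\<^sub>R e \<in> cball 0 \<mu> \<and> \<epsilon> \<le> \<bar>T (f S) (?x + t *\<^sub>R e) - T (f S) ?x\<bar>}"
    have "finite ?D"
      using that
      by (intro finite_weakly_sensitive_directions B(1) in_ball C_space_continuous_map TC fC) auto
    moreover have "{e\<in>B. \<epsilon> \<le> \<bar>G S (insert e A) - G S A\<bar>} \<subseteq> ?D"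
    proof safe
      fix e assume e: "e \<in> B" "\<epsilon> \<le> \<bar>G S (insert e A) - G S A\<bar>"
      have "e \<notin> A"
        using e(2) that(6) by (auto simp: insert_absorb)
      then have eq: "?x + t *\<^sub>R e = t *\<^sub>R \<Sum>(insert e A)"
        using that(4) by (simp add: scaleR_add_right add.commute)
      show "?x + t *\<^sub>R e \<in> cball 0 \<mu>"
        unfolding eq using that e \<open>e \<notin> A\<close> by (intro in_ball) auto
      show "\<epsilon> \<le> \<bar>T (f S) (?x + t *\<^sub>R e) - T (f S) ?x\<bar>"
        unfolding eq using e(2) by (simp only: G_def)
    qed
    ultimately show ?thesis
      by (rule finite_subset [rotated])
  qed
  \<comment> \<open>At most \<open>n\<close> terms are dropped, with a total error of at most \<open>1 / 2\<close>.\<close>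
  define \<delta> where "\<delta> = 1 / (2 * real n)"
  have n\<delta>: "0 < \<delta>" "real n * \<delta> = 1 / 2"
    using m0 by (auto simp: \<delta>_def n_def)
  obtain a :: "nat \<Rightarrow> 'h" where a: "inj_on a {..<n}" "a ` {..<n} \<subseteq> B"
    and free: "\<And>i j. i \<le> j \<Longrightarrow> j \<le> n \<Longrightarrow>
      \<bar>G (a ` {i..<j}) (a ` {..<n}) - G (a ` {i..<j}) (a ` {i..<j})\<bar> \<le> real n * \<delta>"
  proof (rule nearly_free_sequence [OF B(2), of n G \<delta>], goal_cases)
    case 1
    show ?case by (rule fin) (fact 1)+
  next
    case 2
    show ?case by (rule n\<delta>(1))
  next
    case (3 a)
    show ?case by (rule 3(1) [OF 3(2-4)])
  qed
  define J where "J i = a ` {i..<i + m}" for i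
  have J: "J i \<subseteq> B" "finite (J i)" "card (J i) = m" if "i \<le> k" for i
  proof -
    have sub: "{i..<i + m} \<subseteq> {..<n}"
      using that by (auto simp: n_def)
    then show "J i \<subseteq> B"
      using a(2) by (auto simp: J_def)
    show "card (J i) = m"
      unfolding J_def using card_image [OF inj_on_subset [OF a(1) sub]] by simp
  qed (simp add: J_def)
  have J_ne: "J i \<noteq> J j" if "i < j" "j \<le> k" for i j
  proof -
    have "a i \<in> J i"
      using m0 by (simp add: J_def)
    moreover have "a i \<notin> J j"
    proof
      assume "a i \<in> J j"
      then obtain l where "j \<le> l" "l < j + m" "a i = a l"
        by (auto simp: J_def)
      then show False
        using that inj_onD [OF a(1), of i l] by (auto simp: n_def)
    qed
    ultimately show ?thesis by auto
  qed
  define F where "F = (\<lambda>x\<in>cball 0 \<kappa>. \<Sum>i\<le>k. f (J i) x)"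
  define x where "x = t *\<^sub>R \<Sum>(a ` {..<n})"
  have x: "x \<in> cball 0 \<mu>"
    unfolding x_def using a by (intro in_ball) (auto simp: card_image)
  have F: "F \<in> C_space (weak_ball \<kappa>)" and TF: "T F x = (\<Sum>i\<le>k. T (f (J i)) x)"
    using bounded_linear_operator_sum [OF T, of "{..k}" "\<lambda>i. f (J i)"] J fC x
    by (auto simp: F_def top)
  have F_le: "\<bar>F y\<bar> \<le> 1" if "y \<in> cball 0 \<kappa>" for y
  proof (cases "\<exists>i\<le>k. bump s t (J i) y \<noteq> 0")
    case True
    then obtain i where i: "i \<le> k" "bump s t (J i) y \<noteq> 0" by blast
    have "bump s t (J j) y = 0" if "j \<le> k" "j \<noteq> i" for j
    proof -
      have "J i \<noteq> J j"
        using J_ne [of i j] J_ne [of j i] that i by (auto simp: neq_iff)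
      then have "bump s t (J i) y = 0 \<or> bump s t (J j) y = 0"
        using that i \<open>y \<in> cball 0 \<kappa>\<close> s s2
        by (intro bumps_disjoint [OF B(1), where m = m and r = \<kappa>] J) auto
      with i show ?thesis by simp
    qed
    then have "F y = bump s t (J i) y"
      using that i sum.remove [of "{..k}" i "\<lambda>i. bump s t (J i) y"] by (simp add: F_def f_def)
    then show ?thesis
      using bump_bounds [of s t "J i" y] by simp
  next
    case False
    then show ?thesis
      using that by (simp add: F_def f_def)
  qed
  have "1 / 2 \<le> T (f (J i)) x" if "i \<le> k" for i
  proof -
    let ?y = "t *\<^sub>R \<Sum>(J i)"
    have on: "orthonormal (J i)"
      using B(1) J(1) [OF that] by (rule orthonormal_subset)
    have "(norm ?y)\<^sup>2 = \<kappa>\<^sup>2"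
      using norm_scaled_sum_orthonormal [OF on, of t] J [OF that] t2 by simp
    then have y: "?y \<in> cball 0 \<kappa>"
      using assms(2) power2_eq_imp_eq [of "norm ?y" \<kappa>] by simp
    have "?y \<bullet> e = t" if "e \<in> J i" for e
    proof -
      have "\<Sum>(J i) \<bullet> e = (\<Sum>e'\<in>J i. if e' = e then 1 else 0)"
        unfolding inner_sum_left using orthonormal_inner [OF on] that by (intro sum.cong) auto
      then show ?thesis
        using that J(2) [OF \<open>i \<le> k\<close>] by simp
    qed
    then have "f (J i) ?y = 1"
      using y s by (simp add: f_def bump_def ramp_def)
    moreover have "T (f (J i)) ?y = f (J i) ?y"
      using fun_cong [OF ext [OF fC [OF J(2) [OF that]]], of ?y] y by simp
    ultimately have "G (J i) (J i) = 1"
      by (simp add: G_def)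
    moreover have "\<bar>G (J i) (a ` {..<n}) - G (J i) (J i)\<bar> \<le> 1 / 2"
      using free [of i "i + m"] that n\<delta>(2) by (simp add: J_def n_def)
    ultimately have "1 / 2 \<le> G (J i) (a ` {..<n})"
      by linarith
    then show ?thesis
      by (simp add: G_def x_def)
  qed
  then have "(\<Sum>i\<le>k. 1 / 2) \<le> T F x"
    unfolding TF by (intro sum_mono) simp
  also have "\<dots> \<le> sup_norm (weak_ball \<mu>) (T F)"
    using abs_le_sup_norm [OF TC [OF F], of x] x by (simp add: top)
  also have "\<dots> \<le> M * sup_norm (weak_ball \<kappa>) F"
    by (rule M [OF F])
  also have "\<dots> \<le> \<bar>M\<bar> * 1"
  proof (rule mult_mono)
    show "sup_norm (weak_ball \<kappa>) F \<le> 1"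
      using F_le assms(2) by (subst sup_norm_eq_SUP [OF F]) (auto simp: top intro!: cSUP_least)
    show "0 \<le> sup_norm (weak_ball \<kappa>) F"
      using abs_le_sup_norm [OF F, of 0] assms(2) by (simp add: top)
  qed auto
  finally show False
    using k by simp
qed

end
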